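(* Let $F=(f_1,\dots,f_m):\mathbb{R}^n\to\mathbb{R}^m$ be continuously differentiable, let $\sigma\in[0,1)$, $\beta\in(0,1)$ and $x^0\in\mathbb{R}^n$, and let $\{x^k\},\{v^k\},\{t_k\}$ be infinite sequences generated from $x^0$ by the inexact steepest descent method with Armijo rule. Assume that each $v^k$ is scalarization compatible, i.e. there is a sequence $\{w^k\}\subset\operatorname{conv} S$ with $v^k=-JF(x^k)^t w^k$ for all $k=0,1,\dots$. Suppose that $F$ is quasi-convex and that the set $$U:=\{x\in\mathbb{R}^n:\ F(x)\preceq F(x^k),\ k=0,1,\dots\}$$ is nonempty. Then the sequence $\{x^k\}$ converges to a critical Pareto point of $F$.
   Context: Order: for $x,y\in\mathbb{R}^m$, $x\preceq y$ means $y_i-x_i\ge 0$ for all $i$, and $x\prec y$ means $y_i-x_i>0$ for all $i$. Let $I=\{1,\dots,m\}$; norms and inner products are Euclidean. $JF(x)$ is the Jacobian, acting by $JF(x)v=(\langle\nabla f_1(x),v\rangle,\dots,\langle\nabla f_m(x),v\rangle)$, and $JF(x)^t$ is its transpose. $S=\{e_1,\dots,e_m\}$ is the canonical basis of $\mathbb{R}^m$ and $\operatorname{conv}S$ its convex hull. Critical Pareto point: $x\in\mathbb{R}^n$ such that there is no $v\in\mathbb{R}^n$ with $JF(x)v\prec 0$. Set $\alpha(x):=\min_{v\in\mathbb{R}^n}\{\max_{i\in I}\langle\nabla f_i(x),v\rangle+\tfrac12\|v\|^2\}$. For $\sigma\in[0,1)$, a vector $v\in\mathbb{R}^n$ is a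 $\sigma$-approximate steepest descent direction at $x$ for $F$ if $\max_{i\in I}\langle\nabla f_i(x),v\rangle+\tfrac12\|v\|^2\le(1-\sigma)\alpha(x)$. Inexact steepest descent method with Armijo rule: given $\beta\in(0,1)$, $x^0\in\mathbb{R}^n$, for $k=0,1,\dots$: if $x^k$ is a critical Pareto point, stop. Otherwise choose a $\sigma$-approximate steepest descent direction $v^k$ for $F$ at $x^k$, put $$t_k:=\max\{2^{-j}: j\in\{0,1,2,\dots\},\ F(x^k+2^{-j}v^k)\preceq F(x^k)+\beta 2^{-j}JF(x^k)v^k\}$$ and $x^{k+1}:=x^k+t_kv^k$. That the sequences are infinite means the method never stops. $F$ is quasi-convex if for all $x,y\in\mathbb{R}^n$ and $t\in[0,1]$, $F((1-t)x+ty)\preceq\max\{F(x),F(y)\}$, the maximum taken coordinate by coordinate. *)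

theory Defs
  imports "HOL-Analysis.Analysis"
begin

text \<open>
  Throughout, maps are \<^term>\<open>F :: real ^ 'n \<Rightarrow> real ^ 'm\<close> and the index set \<open>I\<close> is the finite type
  \<open>'m\<close>. The order \<open>\<preceq>\<close> is the library's componentwise \<open>\<le>\<close> on vectors. The library's \<open><\<close> on
  vectors is not \<open>\<prec>\<close> (it is \<open>\<le>\<close> together with \<open>\<noteq>\<close>), hence the following definition.
\<close>

definition strictly_below :: "real ^ 'm \<Rightarrow> real ^ 'm \<Rightarrow> bool"  (infix "\<prec>" 50)
  where "x \<prec> y \<longleftrightarrow> (\<forall>i. y $ i - x $ i > 0)"

abbreviation JF :: "(real ^ 'n \<Rightarrow> real ^ 'm) \<Rightarrow> real ^ 'n \<Rightarrow> real ^ 'n ^ 'm"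
  where "JF F x \<equiv> jacobian F (at x)"

definition grad :: "(real ^ 'n \<Rightarrow> real ^ 'm) \<Rightarrow> 'm \<Rightarrow> real ^ 'n \<Rightarrow> real ^ 'n"
  where "grad F i x = row i (JF F x)"

text \<open>The rows of the Jacobian are the gradients of the component functions.\<close>

lemma GDERIV_grad:
  assumes "F differentiable (at x)"
  shows "GDERIV (\<lambda>y. F y $ i) x :> grad F i x"
proof -
  have "(F has_derivative (\<lambda>h. JF F x *v h)) (at x)"
    using assms jacobian_works by blast
  then have "((\<lambda>y. F y $ i) has_derivative (\<lambda>h. (JF F x *v h) $ i)) (at x)"
    by (rule bounded_linear.has_derivative[OF bounded_linear_vec_nth])
  moreover have "(\<lambda>h. (JF F x *v h) $ i) = (\<lambda>h. h \<bullet> grad F i x)"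
    by (simp add: fun_eq_iff grad_def row_def matrix_vector_mul_component inner_commute)
  ultimately show ?thesis
    by (simp add: gderiv_def)
qed

definition continuously_differentiable :: "(real ^ 'n \<Rightarrow> real ^ 'm) \<Rightarrow> bool"
  where "continuously_differentiable F \<longleftrightarrow>
    (\<forall>x. F differentiable (at x)) \<and> continuous_on UNIV (\<lambda>x. JF F x)"

definition critical_Pareto :: "(real ^ 'n \<Rightarrow> real ^ 'm) \<Rightarrow> real ^ 'n \<Rightarrow> bool"
  where "critical_Pareto F x \<longleftrightarrow> \<not> (\<exists>v. JF F x *v v \<prec> 0)"

definition descent_objective :: "(real ^ 'n \<Rightarrow> real ^ 'm) \<Rightarrow> real ^ 'n \<Rightarrow> real ^ 'n \<Rightarrow> real"
  where "descent_objective F x v = (MAX i. grad F i x \<bullet> v) + 1 / 2 * (norm v)\<^sup>2"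

text \<open>\<open>LEAST\<close> and, below, \<open>GREATEST\<close> render minima and maxima of infinite sets of reals.\<close>

definition \<alpha> :: "(real ^ 'n \<Rightarrow> real ^ 'm) \<Rightarrow> real ^ 'n \<Rightarrow> real"
  where "\<alpha> F x = (LEAST a. a \<in> range (descent_objective F x))"

definition approx_steepest_descent ::
    "(real ^ 'n \<Rightarrow> real ^ 'm) \<Rightarrow> real \<Rightarrow> real ^ 'n \<Rightarrow> real ^ 'n \<Rightarrow> bool"
  where "approx_steepest_descent F \<sigma> x v \<longleftrightarrow> descent_objective F x v \<le> (1 - \<sigma>) * \<alpha> F x"

definition Armijo_steps ::
    "(real ^ 'n \<Rightarrow> real ^ 'm) \<Rightarrow> real \<Rightarrow> real ^ 'n \<Rightarrow> real ^ 'n \<Rightarrow> real set"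
  where "Armijo_steps F \<beta> x v =
    {(1 / 2) ^ j | j :: nat.
       F (x + (1 / 2) ^ j *\<^sub>R v) \<le> F x + (\<beta> * (1 / 2) ^ j) *\<^sub>R (JF F x *v v)}"

text \<open>An infinite run of the method: the stopping test fails at every iterate.\<close>

definition inexact_steepest_descent_run ::
    "(real ^ 'n \<Rightarrow> real ^ 'm) \<Rightarrow> real \<Rightarrow> real \<Rightarrow> real ^ 'n \<Rightarrow>
     (nat \<Rightarrow> real ^ 'n) \<Rightarrow> (nat \<Rightarrow> real ^ 'n) \<Rightarrow> (nat \<Rightarrow> real) \<Rightarrow> bool"
  where "inexact_steepest_descent_run F \<sigma> \<beta> x0 x v t \<longleftrightarrow>
    x 0 = x0 \<and>
    (\<forall>k. \<not> critical_Pareto F (x k) \<and>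
         approx_steepest_descent F \<sigma> (x k) (v k) \<and>
         t k = (GREATEST s. s \<in> Armijo_steps F \<beta> (x k) (v k)) \<and>
         x (Suc k) = x k + t k *\<^sub>R v k)"

definition canonical_basis :: "(real ^ 'm) set"
  where "canonical_basis = range (\<lambda>i. axis i 1)"

definition scalarization_compatible ::
    "(real ^ 'n \<Rightarrow> real ^ 'm) \<Rightarrow> (nat \<Rightarrow> real ^ 'n) \<Rightarrow> (nat \<Rightarrow> real ^ 'n) \<Rightarrow> bool"
  where "scalarization_compatible F x v \<longleftrightarrow>
    (\<exists>w :: nat \<Rightarrow> real ^ 'm. (\<forall>k. w k \<in> convex hull canonical_basis) \<and>
       (\<forall>k. v k = - (transpose (JF F (x k)) *v w k)))"

definition quasi_convex :: "(real ^ 'n \<Rightarrow> real ^ 'm) \<Rightarrow> bool"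
  where "quasi_convex F \<longleftrightarrow>
    (\<forall>x y. \<forall>t\<in>{0..1}.
       F ((1 - t) *\<^sub>R x + t *\<^sub>R y) \<le> (\<chi> i. max (F x $ i) (F y $ i)))"

end

theory Submission
  imports Defs
begin

text \<open>
  Quasi-convexity makes every \<open>u \<in> U\<close> satisfy \<open>\<nabla>f\<^sub>i(x\<^sup>k) \<bullet> (u - x\<^sup>k) \<le> 0\<close>, and since
  \<open>v\<^sup>k\<close> is a negative convex combination of gradients, the step does not increase the distance
  to \<open>u\<close> except for the error \<open>\<parallel>t\<^sub>k v\<^sup>k\<parallel>\<^sup>2\<close>. The Armijo condition bounds the sum of these errors
  by the total decrease of \<open>F\<close>, so the iterates are quasi-Fejer convergent to \<open>U\<close>. They are
  bounded, and a cluster point lies in \<open>U\<close> by monotonicity of \<open>F(x\<^sup>k)\<close>; hence the whole sequence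
  converges to it. Were the limit not critical, the directional derivatives along \<open>v\<^sup>k\<close> would be
  bounded away from zero, forcing \<open>t\<^sub>k \<longlonglongrightarrow> 0\<close>; but then the rejected steps \<open>2 t\<^sub>k\<close> contradict,
  by the mean value theorem, the continuity of the gradients.
\<close>

section \<open>Gradients of the components and derivatives along lines\<close>

lemma Jacobian_mult_component: "(JF F x *v v) $ i = grad F i x \<bullet> v"
  by (simp add: grad_def row_def matrix_vector_mul_component)

lemma continuous_on_grad:
  assumes "continuously_differentiable F"
  shows "continuous_on UNIV (grad F i)"
proof -
  have "grad F i = (\<lambda>x. JF F x $ i)"
    by (simp add: fun_eq_iff grad_def row_def vec_eq_iff)
  then show ?thesis
    using assms by (auto simp: continuously_differentiable_def intro!: continuous_intros)
qed

text \<open>Chain rule; it reduces the Armijo, quasi-convexity and mean value arguments to one real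
  variable.\<close>

lemma has_real_derivative_along_line:
  fixes x v :: "real ^ 'n"
  assumes "continuously_differentiable F"
  shows "((\<lambda>s. F (x + s *\<^sub>R v) $ i) has_real_derivative grad F i (x + s *\<^sub>R v) \<bullet> v) (at s)"
proof -
  have "((\<lambda>y. F y $ i) has_derivative (\<lambda>h. h \<bullet> grad F i (x + s *\<^sub>R v))) (at (x + s *\<^sub>R v))"
    using GDERIV_grad[of F "x + s *\<^sub>R v" i] assms
    by (simp add: gderiv_def continuously_differentiable_def)
  moreover have "((\<lambda>s. x + s *\<^sub>R v) has_derivative (\<lambda>h. h *\<^sub>R v)) (at s)"
    by (auto intro!: derivative_eq_intros)
  ultimately have "((\<lambda>s. F (x + s *\<^sub>R v) $ i) has_derivative
      (\<lambda>h. (h *\<^sub>R v) \<bullet> grad F i (x + s *\<^sub>R v))) (at s)"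
    by (rule has_derivative_compose[rotated])
  then show ?thesis
    by (simp add: has_field_derivative_def inner_commute[of v] mult_commute_abs)
qed

section \<open>The descent objective and its minimum \<alpha>\<close>

lemma continuous_on_Max_finite:
  fixes f :: "'i \<Rightarrow> 'a::topological_space \<Rightarrow> real"
  assumes "finite I" "I \<noteq> {}" "\<And>i. i \<in> I \<Longrightarrow> continuous_on A (f i)"
  shows "continuous_on A (\<lambda>x. MAX i\<in>I. f i x)"
  using assms
proof (induction I rule: finite_ne_induct)
  case (singleton i)
  then show ?case by simp
next
  case (insert i I)
  then have "(\<lambda>x. MAX j\<in>insert i I. f j x) = (\<lambda>x. max (f i x) (MAX j\<in>I. f j x))"
    by simp
  with insert show ?case by (auto intro!: continuous_on_max)
qed

lemma grad_le_Max: "grad F i x \<bullet> v \<le> (MAX i. grad F i x \<bullet> v)"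
  by (intro Max_ge) auto

lemma grad_le_descent_objective:
  "grad F i x \<bullet> v + (norm v)\<^sup>2 / 2 \<le> descent_objective F x v"
  using grad_le_Max[of F i x v] by (simp add: descent_objective_def)

lemma descent_objective_less_iff:
  "descent_objective F x v < c \<longleftrightarrow> (\<forall>i. grad F i x \<bullet> v + (norm v)\<^sup>2 / 2 < c)"
proof -
  have "descent_objective F x v < c \<longleftrightarrow> (MAX i. grad F i x \<bullet> v) < c - (norm v)\<^sup>2 / 2"
    by (simp add: descent_objective_def less_diff_eq)
  also have "\<dots> \<longleftrightarrow> (\<forall>i. grad F i x \<bullet> v < c - (norm v)\<^sup>2 / 2)"
    by (subst Max_less_iff) auto
  finally show ?thesis
    by (simp add: less_diff_eq)
qed

text \<open>The quadratic term is at most \<open>- (grad F i x \<bullet> v)\<close>, which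
  Cauchy-Schwarz bounds linearly in \<open>norm v\<close>. This gives compactness of a sublevel set
  below and, later, boundedness of the search directions.\<close>

lemma norm_le_of_descent_objective_nonpos:
  assumes "descent_objective F x v \<le> 0"
  shows "norm v \<le> 2 * norm (grad F i x)"
proof (cases "v = 0")
  case False
  have "(norm v)\<^sup>2 / 2 \<le> - (grad F i x \<bullet> v)"
    using grad_le_descent_objective[of F i x v] assms by linarith
  also have "\<dots> \<le> norm (grad F i x) * norm v"
    using Cauchy_Schwarz_ineq2[of "grad F i x" v] by linarith
  finally have "norm v * norm v \<le> (2 * norm (grad F i x)) * norm v"
    by (simp add: power2_eq_square)
  with False show ?thesis by (simp add: mult_le_cancel_right)
qed simp

text \<open>The \<open>LEAST\<close> in \<alpha> is informative only once the minimum is attained.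
  The sublevel set \<open>K\<close> is compact and contains 0, so the continuous objective attains a
  minimum on it; outside \<open>K\<close> its values are positive.\<close>

lemma \<alpha>_le_descent_objective:
  fixes F :: "real ^ 'n \<Rightarrow> real ^ 'm"
  shows "\<alpha> F x \<le> descent_objective F x u"
proof -
  let ?\<phi> = "descent_objective F x"
  define K where "K = {v. ?\<phi> v \<le> 0}"
  have cont: "continuous_on UNIV ?\<phi>"
    unfolding descent_objective_def
    by (intro continuous_intros continuous_on_Max_finite) auto
  have "closed K"
    unfolding K_def by (intro closed_Collect_le cont continuous_intros)
  moreover have "bounded K"
    using norm_le_of_descent_objective_nonpos unfolding K_def bounded_iff by blast
  ultimately have "compact K"
    by (simp add: compact_eq_bounded_closed)
  moreover have "0 \<in> K"
    by (simp add: K_def descent_objective_def)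
  ultimately obtain m where m: "m \<in> K" "\<And>v. v \<in> K \<Longrightarrow> ?\<phi> m \<le> ?\<phi> v"
    using continuous_attains_inf[of K ?\<phi>] continuous_on_subset[OF cont] by blast
  have min: "?\<phi> m \<le> ?\<phi> v" for v
    using m by (cases "v \<in> K") (auto simp: K_def)
  then have "\<alpha> F x = ?\<phi> m"
    unfolding \<alpha>_def by (intro Least_equality) auto
  with min show ?thesis by simp
qed

text \<open>Shrinking a common descent direction by a small s > 0 scales the linear terms by s but
  the quadratic term by s^2, so the negative linear terms win, uniformly over the finitely many
  components.\<close>

lemma not_critical_imp_descent_objective_neg:
  fixes F :: "real ^ 'n \<Rightarrow> real ^ 'm"
  assumes "\<not> critical_Pareto F x"
  obtains d where "descent_objective F x d < 0"
proof -
  obtain v where v: "\<And>i. grad F i x \<bullet> v < 0"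
    using assms by (auto simp: critical_Pareto_def strictly_below_def Jacobian_mult_component)
  have "\<forall>\<^sub>F s in at_right 0. grad F i x \<bullet> v + s * ((norm v)\<^sup>2 / 2) < 0" for i
  proof -
    have "((\<lambda>s. grad F i x \<bullet> v + s * ((norm v)\<^sup>2 / 2)) \<longlongrightarrow> grad F i x \<bullet> v + 0 * ((norm v)\<^sup>2 / 2))
        (at_right 0)"
      by (intro tendsto_intros)
    then show ?thesis
      using v[of i] by (auto dest: order_tendstoD(2))
  qed
  then have "\<forall>\<^sub>F s in at_right (0::real). \<forall>i. grad F i x \<bullet> v + s * ((norm v)\<^sup>2 / 2) < 0"
    by (rule eventually_all_finite)
  then have "\<forall>\<^sub>F s in at_right (0::real). 0 < s \<and> (\<forall>i. grad F i x \<bullet> v + s * ((norm v)\<^sup>2 / 2) < 0)"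
    using eventually_at_right_less[of "0::real"] by eventually_elim auto
  then obtain s where s: "0 < s" "\<And>i. grad F i x \<bullet> v + s * ((norm v)\<^sup>2 / 2) < 0"
    using eventually_happens[of _ "at_right (0::real)"] by auto
  have "grad F i x \<bullet> (s *\<^sub>R v) + (norm (s *\<^sub>R v))\<^sup>2 / 2 < 0" for i
  proof -
    have "grad F i x \<bullet> (s *\<^sub>R v) + (norm (s *\<^sub>R v))\<^sup>2 / 2
        = s * (grad F i x \<bullet> v + s * ((norm v)\<^sup>2 / 2))"
      using s(1) by (simp add: power2_eq_square algebra_simps)
    with s show ?thesis by (simp add: mult_pos_neg)
  qed
  then show thesis
    using that descent_objective_less_iff by blast
qed

section \<open>The Armijo rule\<close>

lemma mem_Armijo_steps_iff:
  "s \<in> Armijo_steps F \<beta> x v \<longleftrightarrow> (\<exists>j::nat. s = (1/2) ^ j) \<and>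
     (\<forall>i. F (x + s *\<^sub>R v) $ i \<le> F x $ i + \<beta> * s * (grad F i x \<bullet> v))"
  by (auto simp: Armijo_steps_def less_eq_vec_def Jacobian_mult_component)

text \<open>For each component, the difference of the two sides has slope
  \<open>(1 - \<beta>) * (grad F i x \<bullet> v) < 0\<close> at 0. So every component accepts all
  small positive steps, and the powers of 1/2 eventually become that small.\<close>

lemma Armijo_steps_nonempty:
  fixes F :: "real ^ 'n \<Rightarrow> real ^ 'm"
  assumes cd: "continuously_differentiable F" and \<beta>: "\<beta> < 1"
    and v: "\<And>i. grad F i x \<bullet> v < 0"
  shows "Armijo_steps F \<beta> x v \<noteq> {}"
proof -
  have "\<forall>\<^sub>F s in at_right 0. F (x + s *\<^sub>R v) $ i \<le> F x $ i + \<beta> * s * (grad F i x \<bullet> v)" for i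
  proof -
    let ?h = "\<lambda>s. F (x + s *\<^sub>R v) $ i - \<beta> * s * (grad F i x \<bullet> v)"
    have "(?h has_real_derivative grad F i x \<bullet> v - \<beta> * (grad F i x \<bullet> v)) (at 0)"
      using has_real_derivative_along_line[OF cd, of x v i 0]
      by (auto intro!: derivative_eq_intros)
    moreover have "grad F i x \<bullet> v - \<beta> * (grad F i x \<bullet> v) < 0"
      using mult_strict_right_mono_neg[OF \<beta> v[of i]] by simp
    ultimately obtain d where "d > 0" "\<And>s. 0 < s \<Longrightarrow> s < d \<Longrightarrow> ?h s < ?h 0"
      using DERIV_neg_dec_right[of ?h "grad F i x \<bullet> v - \<beta> * (grad F i x \<bullet> v)" 0] by auto
    then show ?thesis
      unfolding eventually_at_right_field by (intro exI[of _ d]) (fastforce simp: algebra_simps)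
  qed
  then have "\<forall>\<^sub>F s in at_right 0. \<forall>i. F (x + s *\<^sub>R v) $ i \<le> F x $ i + \<beta> * s * (grad F i x \<bullet> v)"
    by (rule eventually_all_finite)
  moreover have "filterlim (\<lambda>j. (1/2::real) ^ j) (at_right 0) sequentially"
    by (auto simp: filterlim_at intro!: LIMSEQ_realpow_zero)
  ultimately have "\<forall>\<^sub>F j in sequentially.
      \<forall>i. F (x + (1/2)^j *\<^sub>R v) $ i \<le> F x $ i + \<beta> * (1/2)^j * (grad F i x \<bullet> v)"
    by (rule eventually_compose_filterlim)
  then obtain j :: nat where
    "\<forall>i. F (x + (1/2)^j *\<^sub>R v) $ i \<le> F x $ i + \<beta> * (1/2)^j * (grad F i x \<bullet> v)"
    using eventually_happens by fastforce
  then have "(1/2)^j \<in> Armijo_steps F \<beta> x v"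
    unfolding mem_Armijo_steps_iff by blast
  then show ?thesis by blast
qed

text \<open>The least admissible exponent yields the greatest step, so \<open>GREATEST\<close> is
  attained. Recording that \<open>2 * s\<close> is itself a power of 1/2 ensures that its rejection
  comes from the inequality.\<close>

lemma Greatest_Armijo_step:
  assumes "Armijo_steps F \<beta> x v \<noteq> {}"
  defines "s \<equiv> GREATEST s. s \<in> Armijo_steps F \<beta> x v"
  shows "s \<in> Armijo_steps F \<beta> x v"
    and "s < 1 \<Longrightarrow> 2 * s \<notin> Armijo_steps F \<beta> x v \<and> (\<exists>j::nat. 2 * s = (1/2) ^ j)"
proof -
  let ?P = "\<lambda>j. (1/2::real) ^ j \<in> Armijo_steps F \<beta> x v"
  define j where "j = (LEAST j. ?P j)"
  have "\<exists>j. ?P j"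
    using assms(1) by (auto simp: Armijo_steps_def)
  then have j: "?P j" "\<And>l. ?P l \<Longrightarrow> j \<le> l"
    unfolding j_def by (auto intro: LeastI_ex Least_le)
  have s: "s = (1/2) ^ j"
    unfolding s_def
  proof (rule Greatest_equality)
    show "(1/2) ^ j \<in> Armijo_steps F \<beta> x v" by (rule j(1))
    fix r assume r: "r \<in> Armijo_steps F \<beta> x v"
    then obtain l :: nat where "r = (1/2) ^ l"
      by (auto simp: mem_Armijo_steps_iff)
    with r j(2)[of l] show "r \<le> (1/2) ^ j"
      by (simp add: power_decreasing)
  qed
  with j show "s \<in> Armijo_steps F \<beta> x v" by simp
  assume "s < 1"
  then obtain l where l: "j = Suc l"
    using s by (cases j) auto
  then have "2 * s = (1/2) ^ l" using s by simp
  moreover have "\<not> ?P l" using j(2)[of l] l by auto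
  ultimately show "2 * s \<notin> Armijo_steps F \<beta> x v \<and> (\<exists>j::nat. 2 * s = (1/2) ^ j)"
    by auto
qed

section \<open>Consequences of quasi-convexity and of scalarization compatibility\<close>

lemma quasi_convex_grad_nonpos:
  assumes cd: "continuously_differentiable F" and qc: "quasi_convex F"
    and le: "F u \<le> F x"
  shows "grad F i x \<bullet> (u - x) \<le> 0"
proof (rule ccontr)
  assume "\<not> ?thesis"
  \<comment> \<open>A positive slope would push component \<open>i\<close> above
    \<open>F x $ i\<close> just after leaving \<open>x\<close> towards \<open>u\<close>, whereas
    quasi-convexity and \<open>F u \<le> F x\<close> cap it by \<open>F x $ i\<close> on the whole
    segment.\<close>
  then obtain d where d: "d > 0"
    "\<And>s. 0 < s \<Longrightarrow> s < d \<Longrightarrow> F x $ i < F (x + s *\<^sub>R (u - x)) $ i"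
    using DERIV_pos_inc_right[OF has_real_derivative_along_line[OF cd, of x "u - x" i 0]] by auto
  define s where "s = min (d / 2) 1"
  have s: "0 < s" "s < d" "s \<le> 1"
    using d(1) by (auto simp: s_def)
  have "F ((1 - s) *\<^sub>R x + s *\<^sub>R u) \<le> (\<chi> i. max (F x $ i) (F u $ i))"
    using qc s by (simp add: quasi_convex_def)
  moreover have "(1 - s) *\<^sub>R x + s *\<^sub>R u = x + s *\<^sub>R (u - x)"
    by (simp add: algebra_simps)
  ultimately have "F (x + s *\<^sub>R (u - x)) $ i \<le> F x $ i"
    using le by (auto simp: less_eq_vec_def max_absorb1)
  with d(2)[OF s(1,2)] show False by simp
qed

lemma mem_convex_hull_canonical_basis_nonneg:
  assumes "w \<in> convex hull (canonical_basis :: (real ^ 'm) set)"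
  shows "0 \<le> w $ i"
proof -
  have "convex {w :: real ^ 'm. 0 \<le> w $ i}"
    by (auto simp: convex_def)
  moreover have "canonical_basis \<subseteq> {w :: real ^ 'm. 0 \<le> w $ i}"
    by (auto simp: canonical_basis_def axis_def)
  ultimately have "convex hull canonical_basis \<subseteq> {w :: real ^ 'm. 0 \<le> w $ i}"
    by (intro hull_minimal)
  with assms show ?thesis by auto
qed

text \<open>Moving the transpose across the inner product writes \<open>v k \<bullet> d\<close> as a
  combination of the nonnegative numbers \<open>- (grad F i (x k) \<bullet> d)\<close> with
  nonnegative weights. It is applied with \<open>d = u - x k\<close>.\<close>

lemma scalarization_compatible_inner_nonneg:
  assumes "scalarization_compatible F x v"
    and "\<And>i. grad F i (x k) \<bullet> d \<le> 0"
  shows "0 \<le> v k \<bullet> d"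
proof -
  obtain w where w: "w \<in> convex hull canonical_basis" "v k = - (transpose (JF F (x k)) *v w)"
    using assms(1) by (auto simp: scalarization_compatible_def)
  have "v k \<bullet> d = - (w \<bullet> (JF F (x k) *v d))"
    unfolding w(2) by (simp add: dot_lmul_matrix[symmetric])
  also have "\<dots> = (\<Sum>i\<in>UNIV. w $ i * - (grad F i (x k) \<bullet> d))"
    by (simp add: inner_vec_def Jacobian_mult_component sum_negf)
  also have "\<dots> \<ge> 0"
    using assms(2) mem_convex_hull_canonical_basis_nonneg[OF w(1)]
    by (intro sum_nonneg mult_nonneg_nonneg) auto
  finally show ?thesis .
qed

section \<open>Summable errors and quasi-Fejer convergence\<close>

lemma summable_of_telescoping_bound:
  fixes a b :: "nat \<Rightarrow> real"
  assumes nonneg: "\<And>k. 0 \<le> b k" and step: "\<And>k. b k \<le> a k - a (Suc k)"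
    and lower: "\<And>k. c \<le> a k"
  shows "summable b"
proof (rule bounded_imp_summable[OF nonneg])
  fix n
  have "(\<Sum>k\<le>n. b k) \<le> (\<Sum>k\<le>n. a k - a (Suc k))"
    by (intro sum_mono step)
  also have "\<dots> = a 0 - a (Suc n)"
    by (rule sum_telescope)
  also have "\<dots> \<le> a 0 - c"
    using lower by simp
  finally show "(\<Sum>k\<le>n. b k) \<le> a 0 - c" .
qed

text \<open>Subtracting the accumulated errors makes the sequence decreasing and bounded below; the
  convergent partial sums are then added back.\<close>

lemma quasi_Fejer_convergent:
  fixes a e :: "nat \<Rightarrow> real"
  assumes e: "summable e" "\<And>k. 0 \<le> e k"
    and step: "\<And>k. a (Suc k) \<le> a k + e k" and a: "\<And>k. 0 \<le> a k"
  shows "convergent a"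
proof -
  let ?S = "\<lambda>k. sum e {..<k}"
  have S: "?S k \<le> suminf e" for k
    using e by (intro sum_le_suminf) auto
  have "decseq (\<lambda>k. a k - ?S k)"
    using step by (intro decseq_SucI) (simp add: algebra_simps)
  moreover have "- suminf e \<le> a k - ?S k" for k
    using S[of k] a[of k] by linarith
  ultimately obtain L where "(\<lambda>k. a k - ?S k) \<longlonglongrightarrow> L"
    using decseq_convergent[of "\<lambda>k. a k - ?S k" "- suminf e"] by blast
  then have "(\<lambda>k. a k - ?S k + ?S k) \<longlonglongrightarrow> L + suminf e"
    by (intro tendsto_add summable_LIMSEQ e)
  then show ?thesis
    by (auto intro: convergentI)
qed

text \<open>Distances to any point of \<open>U\<close> converge, so the sequence is bounded and has
  a cluster point \<open>l\<close>. As \<open>l\<close> lies in \<open>U\<close>, the distances to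
  \<open>l\<close> converge too, and a subsequence forces their limit to be 0.\<close>

lemma quasi_Fejer_LIMSEQ:
  fixes x :: "nat \<Rightarrow> 'a::heine_borel"
  assumes e: "summable e" "\<And>k. 0 \<le> e k"
    and fejer: "\<And>u k. u \<in> U \<Longrightarrow> (dist (x (Suc k)) u)\<^sup>2 \<le> (dist (x k) u)\<^sup>2 + e k"
    and ne: "U \<noteq> {}"
    and cluster: "\<And>l r. strict_mono r \<Longrightarrow> (x \<circ> r) \<longlonglongrightarrow> l \<Longrightarrow> l \<in> U"
  obtains l where "l \<in> U" "x \<longlonglongrightarrow> l"
proof -
  have conv: "convergent (\<lambda>k. (dist (x k) u)\<^sup>2)" if "u \<in> U" for u
    using fejer[OF that] by (intro quasi_Fejer_convergent[OF e]) auto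
  obtain u where "u \<in> U" using ne by blast
  then have "Bseq (\<lambda>k. (dist (x k) u)\<^sup>2)"
    using conv convergent_imp_Bseq by blast
  then obtain B where B: "\<And>k. (dist (x k) u)\<^sup>2 \<le> B"
    by (auto simp: Bseq_def)
  have "dist u (x k) \<le> sqrt B" for k
    using real_le_rsqrt[OF B[of k]] by (simp add: dist_commute)
  then have "bounded (range x)"
    unfolding bounded_def by blast
  then obtain l r where lr: "strict_mono r" "(x \<circ> r) \<longlonglongrightarrow> l"
    using bounded_imp_convergent_subsequence by blast
  then have l: "l \<in> U" by (rule cluster)
  then obtain L where L: "(\<lambda>k. (dist (x k) l)\<^sup>2) \<longlonglongrightarrow> L"
    using conv convergent_def by blast
  have "((\<lambda>k. (dist (x k) l)\<^sup>2) \<circ> r) \<longlonglongrightarrow> L"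
    using LIMSEQ_subseq_LIMSEQ[OF L lr(1)] .
  moreover have "((\<lambda>k. (dist (x k) l)\<^sup>2) \<circ> r) \<longlonglongrightarrow> 0"
    using tendsto_power[OF tendsto_dist[OF lr(2) tendsto_const[of l]], of 2] by (simp add: o_def)
  ultimately have "L = 0"
    using LIMSEQ_unique by blast
  with L have "(\<lambda>k. sqrt ((dist (x k) l)\<^sup>2)) \<longlonglongrightarrow> sqrt 0"
    by (intro tendsto_intros) auto
  then have "(\<lambda>k. dist (x k) l) \<longlonglongrightarrow> 0" by simp
  then have "x \<longlonglongrightarrow> l"
    by (rule tendsto_dist_iff[THEN iffD2])
  with l that show thesis by blast
qed

section \<open>Convergence of the iterates and criticality of their limit\<close>

theorem theorem5p2:
  fixes F :: "real ^ 'n \<Rightarrow> real ^ 'm"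
    and \<sigma> \<beta> :: real
    and x0 :: "real ^ 'n"
    and x v :: "nat \<Rightarrow> real ^ 'n"
    and t :: "nat \<Rightarrow> real"
  assumes "continuously_differentiable F"
    and "0 \<le> \<sigma>" and "\<sigma> < 1"
    and "0 < \<beta>" and "\<beta> < 1"
    and "inexact_steepest_descent_run F \<sigma> \<beta> x0 x v t"
    and "scalarization_compatible F x v"
    and "quasi_convex F"
    and "{u. \<forall>k. F u \<le> F (x k)} \<noteq> {}"
  shows "\<exists>xs. x \<longlonglongrightarrow> xs \<and> critical_Pareto F xs"
proof -
  note cd = assms(1)
  note \<sigma> = assms(2,3)
  note \<beta> = assms(4,5)
  define U where "U = {u. \<forall>k. F u \<le> F (x k)}"
  have run: "\<not> critical_Pareto F (x k)" "approx_steepest_descent F \<sigma> (x k) (v k)"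
    "t k = (GREATEST s. s \<in> Armijo_steps F \<beta> (x k) (v k))"
    "x (Suc k) = x k + t k *\<^sub>R v k" for k
    using assms(6) by (auto simp: inexact_steepest_descent_run_def)
  \<comment> \<open>Replacing \<alpha> by an arbitrary trial direction \<open>d\<close> allows one
    fixed \<open>d\<close> to be used later for all large \<open>k\<close>.\<close>
  have obj_le: "descent_objective F (x k) (v k) \<le> (1 - \<sigma>) * descent_objective F (x k) d" for k d
  proof -
    have "(1 - \<sigma>) * \<alpha> F (x k) \<le> (1 - \<sigma>) * descent_objective F (x k) d"
      using \<sigma> by (intro mult_left_mono \<alpha>_le_descent_objective) simp
    with run(2)[of k] show ?thesis
      unfolding approx_steepest_descent_def by (rule order_trans)
  qed
  have obj_neg: "descent_objective F (x k) (v k) < 0" for k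
  proof -
    obtain d where "descent_objective F (x k) d < 0"
      using not_critical_imp_descent_objective_neg[OF run(1)] .
    with \<sigma> have "(1 - \<sigma>) * descent_objective F (x k) d < 0"
      by (simp add: mult_pos_neg)
    with obj_le[of k d] show ?thesis by linarith
  qed
  then have grad_v: "grad F i (x k) \<bullet> v k + (norm (v k))\<^sup>2 / 2 < 0" for i k
    using descent_objective_less_iff by blast
  have grad_neg: "grad F i (x k) \<bullet> v k < 0" for i k
    using grad_v[of i k] zero_le_power2[of "norm (v k)"] by linarith
  have ne: "Armijo_steps F \<beta> (x k) (v k) \<noteq> {}" for k
    by (rule Armijo_steps_nonempty[OF cd \<beta>(2) grad_neg])
  have t_mem: "t k \<in> Armijo_steps F \<beta> (x k) (v k)" for k
    using Greatest_Armijo_step(1)[OF ne] run(3) by simp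
  have t_pos: "0 < t k" and t_le1: "t k \<le> 1" for k
    using t_mem[of k] by (auto simp: mem_Armijo_steps_iff power_le_one)
  have decrease: "F (x (Suc k)) $ i \<le> F (x k) $ i + \<beta> * t k * (grad F i (x k) \<bullet> v k)" for i k
    using t_mem[of k] run(4)[of k] by (auto simp: mem_Armijo_steps_iff)
  have F_decseq: "decseq (\<lambda>k. F (x k) $ i)" for i
  proof (rule decseq_SucI)
    fix k
    have "\<beta> * t k * (grad F i (x k) \<bullet> v k) \<le> 0"
      using \<beta> t_pos[of k] grad_neg[of i k] by (intro mult_nonneg_nonpos) auto
    with decrease[of k i] show "F (x (Suc k)) $ i \<le> F (x k) $ i" by linarith
  qed
  obtain u where u: "\<And>k. F u \<le> F (x k)"
    using assms(9) by blast
  \<comment> \<open>The decrease of a single, arbitrary component controls all the errors;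
    \<open>F u $ i0\<close> bounds its telescoping sum.\<close>
  fix i0 :: 'm
  have "summable (\<lambda>k. \<beta> * (t k * - (grad F i0 (x k) \<bullet> v k)))"
  proof (rule summable_of_telescoping_bound)
    show "0 \<le> \<beta> * (t k * - (grad F i0 (x k) \<bullet> v k))" for k
      using \<beta> t_pos[of k] grad_neg[of i0 k] by (intro mult_nonneg_nonneg) auto
    show "\<beta> * (t k * - (grad F i0 (x k) \<bullet> v k)) \<le> F (x k) $ i0 - F (x (Suc k)) $ i0" for k
      using decrease[of k i0] by simp
    show "F u $ i0 \<le> F (x k) $ i0" for k
      using u[of k] by (simp add: less_eq_vec_def)
  qed
  then have sum_grad: "summable (\<lambda>k. t k * - (grad F i0 (x k) \<bullet> v k))"
    using \<beta> by (subst (asm) summable_cmult_iff) auto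
  define e where "e k = (norm (t k *\<^sub>R v k))\<^sup>2" for k
  have "summable e"
  \<comment> \<open>\<open>t k \<le> 1\<close> absorbs one factor of the squared step size, and
    \<open>grad_v\<close> bounds \<open>(norm (v k))\<^sup>2\<close> by twice the negated
    directional derivative.\<close>
  proof (rule summable_comparison_test'[OF summable_mult[OF sum_grad, of 2]])
    fix k
    have "e k = t k * (t k * (norm (v k))\<^sup>2)"
      using t_pos[of k] by (simp add: e_def power_mult_distrib power2_eq_square)
    also have "\<dots> \<le> t k * (1 * (norm (v k))\<^sup>2)"
      using t_pos[of k] t_le1[of k] by (intro mult_left_mono mult_right_mono) auto
    also have "\<dots> \<le> t k * (2 * - (grad F i0 (x k) \<bullet> v k))"
      using t_pos[of k] grad_v[of i0 k] by (intro mult_left_mono) auto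
    finally show "norm (e k) \<le> 2 * (t k * - (grad F i0 (x k) \<bullet> v k))"
      by (simp add: e_def)
  qed
  have F_isCont: "isCont F y" for y
    using cd differentiable_imp_continuous_within
    by (auto simp: continuously_differentiable_def)
  obtain xs where xs: "x \<longlonglongrightarrow> xs"
  proof (rule quasi_Fejer_LIMSEQ[OF \<open>summable e\<close>])
    show "0 \<le> e k" for k
      by (simp add: e_def)
    show "U \<noteq> {}"
      using assms(9) by (simp add: U_def)
    show "(dist (x (Suc k)) u)\<^sup>2 \<le> (dist (x k) u)\<^sup>2 + e k" if "u \<in> U" for u k
    proof -
      have "grad F i (x k) \<bullet> (u - x k) \<le> 0" for i
        using that by (intro quasi_convex_grad_nonpos[OF cd assms(8)]) (simp add: U_def)
      then have "0 \<le> v k \<bullet> (u - x k)"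
        by (rule scalarization_compatible_inner_nonneg[OF assms(7)])
      then have "0 \<le> (t k *\<^sub>R v k) \<bullet> (u - x k)"
        using t_pos[of k] by simp
      \<comment> \<open>Expanding the square leaves a cross term whose sign has just been
        determined, with \<open>e k\<close> as the only error.\<close>
      moreover have "(dist (x (Suc k)) u)\<^sup>2
          = (dist (x k) u)\<^sup>2 + e k - 2 * ((t k *\<^sub>R v k) \<bullet> (u - x k))"
        unfolding dist_norm power2_norm_eq_inner e_def run(4)
        by (simp only: inner_diff_left inner_diff_right inner_add_left inner_add_right
            inner_commute) (simp add: algebra_simps inner_commute)
      ultimately show ?thesis by linarith
    qed
    show "l \<in> U" if r: "strict_mono r" and l: "(x \<circ> r) \<longlonglongrightarrow> l" for l r
    proof -
      have "F l $ i \<le> F (x k) $ i" for k i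
      proof (rule LIMSEQ_le_const2)
        show "(\<lambda>j. F (x (r j)) $ i) \<longlonglongrightarrow> F l $ i"
          using isCont_tendsto_compose[OF F_isCont l] by (auto intro: tendsto_vec_nth simp: o_def)
        \<comment> \<open>Here \<open>k \<le> j \<le> r j\<close>, so monotonicity of the values
          along the run applies.\<close>
        have "F (x (r j)) $ i \<le> F (x k) $ i" if "k \<le> j" for j
          using decseqD[OF F_decseq, of k "r j" i] seq_suble[OF r, of j] that by simp
        then show "\<exists>N. \<forall>j\<ge>N. F (x (r j)) $ i \<le> F (x k) $ i" by blast
      qed
      then show ?thesis
        by (simp add: U_def less_eq_vec_def)
    qed
  qed
  have grad_isCont: "isCont (grad F i) y" for i y
    using continuous_on_grad[OF cd] by (simp add: continuous_on_eq_continuous_at)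
  then have grad_lim: "(\<lambda>k. grad F i (x k)) \<longlonglongrightarrow> grad F i xs" for i
    using isCont_tendsto_compose xs by blast
  have "critical_Pareto F xs"
  proof (rule ccontr)
    assume "\<not> ?thesis"
    then obtain d where d: "descent_objective F xs d < 0"
      using not_critical_imp_descent_objective_neg by blast
    \<comment> \<open>Halving leaves room: the objective of \<open>d\<close> is
      \<open>- 2 * c\<close> at \<open>xs\<close>, hence below \<open>- c\<close> at nearby
      iterates. The factor \<open>1 - \<sigma>\<close> in \<delta> pays for the inexact choice of
      \<open>v k\<close>.\<close>
    define c where "c = - descent_objective F xs d / 2"
    define \<delta> where "\<delta> = (1 - \<sigma>) * c"
    have "0 < c"
      using d by (simp add: c_def)
    with \<sigma> have \<delta>: "0 < \<delta>"
      by (simp add: \<delta>_def)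
    have "\<forall>\<^sub>F k in sequentially. grad F i (x k) \<bullet> d + (norm d)\<^sup>2 / 2 < - c" for i
    proof (rule order_tendstoD(2))
      show "(\<lambda>k. grad F i (x k) \<bullet> d + (norm d)\<^sup>2 / 2) \<longlonglongrightarrow> grad F i xs \<bullet> d + (norm d)\<^sup>2 / 2"
        by (intro tendsto_intros grad_lim)
      show "grad F i xs \<bullet> d + (norm d)\<^sup>2 / 2 < - c"
        using grad_le_descent_objective[of F i xs d] d by (simp add: c_def)
    qed
    then have "\<forall>\<^sub>F k in sequentially. \<forall>i. grad F i (x k) \<bullet> d + (norm d)\<^sup>2 / 2 < - c"
      by (rule eventually_all_finite)
    then have steep: "\<forall>\<^sub>F k in sequentially. \<forall>i. grad F i (x k) \<bullet> v k \<le> - \<delta>"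
    proof eventually_elim
      case (elim k)
      then have "descent_objective F (x k) d < - c"
        by (simp add: descent_objective_less_iff)
      then have "(1 - \<sigma>) * descent_objective F (x k) d \<le> - \<delta>"
        using mult_left_mono[of "descent_objective F (x k) d" "- c" "1 - \<sigma>"] \<sigma>
        by (simp add: \<delta>_def)
      with obj_le[of k d] have obj: "descent_objective F (x k) (v k) \<le> - \<delta>" by linarith
      show ?case
      proof
        fix i
        have "0 \<le> (norm (v k))\<^sup>2 / 2" by simp
        with grad_le_descent_objective[of F i "x k" "v k"] obj
        show "grad F i (x k) \<bullet> v k \<le> - \<delta>" by linarith
      qed
    qed
    have t_lim: "t \<longlonglongrightarrow> 0"
    proof (rule tendsto_sandwich[OF _ _ tendsto_const])
      show "\<forall>\<^sub>F k in sequentially. 0 \<le> t k"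
        using t_pos by (simp add: less_imp_le)
      \<comment> \<open>Steepness bounds the steps by the terms of a convergent series, up to the
        factor 1/\<delta>.\<close>
      show "\<forall>\<^sub>F k in sequentially. t k \<le> (t k * - (grad F i0 (x k) \<bullet> v k)) / \<delta>"
        using steep
      proof eventually_elim
        case (elim k)
        then have "t k * \<delta> \<le> t k * - (grad F i0 (x k) \<bullet> v k)"
          using t_pos[of k] by (intro mult_left_mono) (auto simp: le_minus_iff)
        with \<delta> show ?case by (simp only: pos_le_divide_eq)
      qed
      show "(\<lambda>k. (t k * - (grad F i0 (x k) \<bullet> v k)) / \<delta>) \<longlonglongrightarrow> 0"
        using tendsto_divide[OF summable_LIMSEQ_zero[OF sum_grad] tendsto_const[of \<delta>]] \<delta> by simp
    qed
    obtain B where B: "0 < B" "\<And>k. norm (v k) \<le> B"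
    proof -
      obtain C where C: "0 < C" "\<And>k. norm (grad F i0 (x k)) \<le> C"
        using convergent_imp_Bseq[OF convergentI[OF grad_lim[of i0]]] by (auto simp: Bseq_def)
      have "norm (v k) \<le> 2 * C" for k
        using norm_le_of_descent_objective_nonpos[OF less_imp_le[OF obj_neg[of k]], of i0] C(2)[of k]
        by linarith
      with C(1) that show thesis by (metis mult_pos_pos zero_less_numeral)
    qed
    \<comment> \<open>Chosen so that \<open>2 * \<epsilon> * B\<close> equals the gap
      \<open>(1 - \<beta>) * \<delta>\<close> required by a rejected step.\<close>
    define \<epsilon> where "\<epsilon> = (1 - \<beta>) * \<delta> / (2 * B)"
    have \<epsilon>: "0 < \<epsilon>"
      using \<beta> \<delta> B by (simp add: \<epsilon>_def)
    have "\<forall>\<^sub>F y in nhds xs. dist (grad F i y) (grad F i xs) < \<epsilon>" for i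
      using grad_isCont[of xs i] \<epsilon> by (simp add: isCont_def tendsto_at_iff_tendsto_nhds tendstoD)
    then have "\<forall>\<^sub>F y in nhds xs. \<forall>i. dist (grad F i y) (grad F i xs) < \<epsilon>"
      by (rule eventually_all_finite)
    then obtain r where r: "0 < r" "\<And>y i. dist y xs < r \<Longrightarrow> dist (grad F i y) (grad F i xs) < \<epsilon>"
      by (auto simp: eventually_nhds_metric)
    have "\<forall>\<^sub>F k in sequentially. dist (x k) xs < r / 2"
      using r(1) by (intro tendstoD[OF xs]) simp
    \<comment> \<open>The bound 1 makes \<open>2 * t k\<close> a rejected candidate; the other gives
      \<open>2 * t k * B < r / 2\<close>, which keeps the trial segment within \<open>r\<close> of
      \<open>xs\<close>.\<close>
    moreover have "\<forall>\<^sub>F k in sequentially. t k < min 1 (r / (4 * B))"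
      using t_lim r(1) B(1) by (intro order_tendstoD(2)) auto
    ultimately have "\<forall>\<^sub>F k in sequentially. dist (x k) xs < r / 2 \<and> t k < min 1 (r / (4 * B)) \<and>
        (\<forall>i. grad F i (x k) \<bullet> v k \<le> - \<delta>)"
      using steep by eventually_elim auto
    then obtain k where k: "dist (x k) xs < r / 2" "t k < 1" "t k < r / (4 * B)"
      "\<And>i. grad F i (x k) \<bullet> v k \<le> - \<delta>"
      using eventually_happens[of _ sequentially] by auto
    have "2 * t k \<notin> Armijo_steps F \<beta> (x k) (v k) \<and> (\<exists>j::nat. 2 * t k = (1/2) ^ j)"
      using Greatest_Armijo_step(2)[OF ne[of k]] k(2) run(3)[of k] by simp
    then obtain i where i:
      "F (x k) $ i + \<beta> * (2 * t k) * (grad F i (x k) \<bullet> v k) < F (x k + (2 * t k) *\<^sub>R v k) $ i"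
      by (auto simp: mem_Armijo_steps_iff not_le)
    \<comment> \<open>The mean value theorem turns the failed inequality into a gradient change:
      from \<open>x k\<close> to \<open>?y\<close>, the derivative along \<open>v k\<close> must
      grow by more than \<open>(1 - \<beta>) * \<delta>\<close>, too much for two gradients within
      \<epsilon> of that at \<open>xs\<close>.\<close>
    obtain z where z: "0 < z" "z < 2 * t k" and mvt:
      "F (x k + (2 * t k) *\<^sub>R v k) $ i - F (x k + 0 *\<^sub>R v k) $ i
        = (2 * t k - 0) * (grad F i (x k + z *\<^sub>R v k) \<bullet> v k)"
      using MVT2[of 0 "2 * t k" "\<lambda>s. F (x k + s *\<^sub>R v k) $ i"]
        has_real_derivative_along_line[OF cd] t_pos[of k] by force
    let ?y = "x k + z *\<^sub>R v k"
    have "(2 * t k) * (\<beta> * (grad F i (x k) \<bullet> v k)) < (2 * t k) * (grad F i ?y \<bullet> v k)"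
      using i mvt by (simp add: algebra_simps)
    then have "\<beta> * (grad F i (x k) \<bullet> v k) < grad F i ?y \<bullet> v k"
      using t_pos[of k] by simp
    moreover have "(1 - \<beta>) * \<delta> \<le> (1 - \<beta>) * - (grad F i (x k) \<bullet> v k)"
      using k(4)[of i] \<beta> by (intro mult_left_mono) auto
    ultimately have "(1 - \<beta>) * \<delta> < (grad F i ?y - grad F i (x k)) \<bullet> v k"
      by (simp add: algebra_simps)
    also have "\<dots> \<le> norm (grad F i ?y - grad F i (x k)) * norm (v k)"
      by (rule norm_cauchy_schwarz)
    also have "\<dots> \<le> (2 * \<epsilon>) * B"
    proof (intro mult_mono B)
      have "norm (z *\<^sub>R v k) \<le> (2 * t k) * B"
        using z B(2)[of k] by (auto intro!: mult_mono)
      also have "\<dots> < r / 2"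
        using k(3) B(1) by (simp add: field_simps)
      finally have "dist ?y (x k) < r / 2"
        by (simp add: dist_norm)
      then have "dist ?y xs < r"
        using k(1) dist_triangle[of ?y xs "x k"] by linarith
      moreover have "dist (x k) xs < r"
        using k(1) r(1) by linarith
      ultimately have "dist (grad F i ?y) (grad F i xs) < \<epsilon>" "dist (grad F i (x k)) (grad F i xs) < \<epsilon>"
        using r(2) by blast+
      then show "norm (grad F i ?y - grad F i (x k)) \<le> 2 * \<epsilon>"
        using dist_triangle2[of "grad F i ?y" "grad F i (x k)" "grad F i xs"]
        by (simp add: dist_norm[symmetric])
    qed (use \<epsilon> in auto)
    also have "\<dots> = (1 - \<beta>) * \<delta>"
      using B(1) by (simp add: \<epsilon>_def)
    finally show False by simp
  qed
  with xs show ?thesis by blast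
qed

end
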